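(* Let $A, B$ be two calculable sets that are canonically arranged, with labelling functions $l_A, l_B$ (so $l_A(x)=l_B(x)$ for all $x\in A\cap B$), and let $A\cup B$ carry the common labelling. Then: (i) $\sigma(A) = 0$ if and only if $A = \emptyset$. (ii) If $A$ is finite with $|A| = n$ for some $n\in\mathbb N$, then $\sigma(A) =_{\mathcal F} (n)$, where $(n)$ is the constant sequence with value $n$. (iii) If $A$ is a proper subset of $B$, then $\sigma(A) <_{\mathcal F} \sigma(B)$. (iv) If $A\cap B=\emptyset$, then $\sigma(A\cup B) = \sigma(A) + \sigma(B)$. (v) If $\sigma(A) <_{\mathcal F} \sigma(B)$, then $\sigma(A) + 1 \leq_{\mathcal F} \sigma(B)$.
   Context: $\mathbb N=\{1,2,3,\dots\}$. A set $A$ is calculable if it is arranged as a union $A=\bigcup\{A_n : n\in\mathbb N\}$ of pairwise disjoint finite (possibly empty) sets $A_n$. The arrangement is given by a finite-to-one labelling function $l_A:A\to\mathbb N$ with $l_A(x)=n \Leftrightarrow x\in A_n$. The size sequence of $A$ is $\sigma(A)=(\sigma_n(A))_{n\in\mathbb N}$, where $\sigma_n(A)=|A_1|+\dots+|A_n| = |\{x\in A: l_A(x)\le n\}|$, a sequence of nonnegative integers. Canonically arranged sets have labellings that agree on common elements: if $A,B$ are canonically arranged and $x\in A\cap B$, then $l_A(x)=l_B(x)$. The union $A\cup B$ is labelled by the common extension of $l_A$ and $l_B$. Operations on sequences are termwise; an integer $k$ is identified with the constant sequence $(k)$; unsubscripted $=$ between sequences is termwise equality. For sequences $(a_n),(b_n)$: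 $(a_n)=_{\mathcal F}(b_n)$ iff $\exists m\,\forall n>m,\ a_n=b_n$; $(a_n)<_{\mathcal F}(b_n)$ iff $\exists m\,\forall n>m,\ a_n<b_n$; $(a_n)\le_{\mathcal F}(b_n)$ iff $\exists m\,\forall n>m,\ a_n\le b_n$. *)

theory Defs
  imports Main
begin

text \<open>
  The natural numbers of the source start at 1. They are rendered by the type \<^typ>\<open>nat\<close> with
  explicit bounds \<open>\<ge> 1\<close> on labels and indices; sequences are functions on \<^typ>\<open>nat\<close> whose
  value at 0 carries no meaning. A labelling is a total function of which only the values on
  the labelled set matter.
\<close>

definition component :: "'a set \<Rightarrow> ('a \<Rightarrow> nat) \<Rightarrow> nat \<Rightarrow> 'a set" where
  "component A l n = {x \<in> A. l x = n}"

definition calculable :: "'a set \<Rightarrow> ('a \<Rightarrow> nat) \<Rightarrow> bool" where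
  "calculable A l \<longleftrightarrow> (\<forall>x\<in>A. 1 \<le> l x) \<and> (\<forall>n\<ge>1. finite (component A l n))"

definition canonically_arranged ::
    "'a set \<Rightarrow> ('a \<Rightarrow> nat) \<Rightarrow> 'a set \<Rightarrow> ('a \<Rightarrow> nat) \<Rightarrow> bool" where
  "canonically_arranged A lA B lB \<longleftrightarrow> (\<forall>x\<in>A \<inter> B. lA x = lB x)"

definition union_label :: "'a set \<Rightarrow> ('a \<Rightarrow> nat) \<Rightarrow> ('a \<Rightarrow> nat) \<Rightarrow> 'a \<Rightarrow> nat" where
  "union_label A lA lB x = (if x \<in> A then lA x else lB x)"

definition size_seq :: "'a set \<Rightarrow> ('a \<Rightarrow> nat) \<Rightarrow> nat \<Rightarrow> nat" where
  "size_seq A l n = (\<Sum>k=1..n. card (component A l k))"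

definition eventually_eq :: "(nat \<Rightarrow> 'b) \<Rightarrow> (nat \<Rightarrow> 'b) \<Rightarrow> bool" (infix "=\<^sub>\<F>" 50) where
  "a =\<^sub>\<F> b \<longleftrightarrow> (\<exists>m\<ge>1. \<forall>n>m. a n = b n)"

definition eventually_less :: "(nat \<Rightarrow> 'b::ord) \<Rightarrow> (nat \<Rightarrow> 'b) \<Rightarrow> bool" (infix "<\<^sub>\<F>" 50) where
  "a <\<^sub>\<F> b \<longleftrightarrow> (\<exists>m\<ge>1. \<forall>n>m. a n < b n)"

definition eventually_le :: "(nat \<Rightarrow> 'b::ord) \<Rightarrow> (nat \<Rightarrow> 'b) \<Rightarrow> bool" (infix "\<le>\<^sub>\<F>" 50) where
  "a \<le>\<^sub>\<F> b \<longleftrightarrow> (\<exists>m\<ge>1. \<forall>n>m. a n \<le> b n)"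

lemma Union_component:
  assumes "calculable A l"
  shows "A = (\<Union>n\<in>{1..}. component A l n)"
  using assms by (auto simp: calculable_def component_def)

lemma size_seq_eq_card:
  assumes "calculable A l"
  shows "size_seq A l n = card {x \<in> A. l x \<le> n}"
proof -
  have "{x \<in> A. l x \<le> n} = (\<Union>k\<in>{1..n}. component A l k)"
    using assms by (auto simp: calculable_def component_def)
  moreover have "card (\<Union>k\<in>{1..n}. component A l k) = (\<Sum>k=1..n. card (component A l k))"
    by (rule card_UN_disjoint) (use assms in \<open>auto simp: calculable_def component_def\<close>)
  ultimately show ?thesis by (simp add: size_seq_def)
qed

lemma union_label_extends:
  assumes "canonically_arranged A lA B lB"
  shows "x \<in> A \<Longrightarrow> union_label A lA lB x = lA x"
    and "x \<in> B \<Longrightarrow> union_label A lA lB x = lB x"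
  using assms by (auto simp: canonically_arranged_def union_label_def)

lemma calculable_Un:
  assumes "calculable A lA" "calculable B lB"
  shows "calculable (A \<union> B) (union_label A lA lB)"
proof -
  have "component (A \<union> B) (union_label A lA lB) n \<subseteq> component A lA n \<union> component B lB n" for n
    by (auto simp: component_def union_label_def)
  moreover have "finite (component A lA n \<union> component B lB n)" if "1 \<le> n" for n
    using assms that by (simp add: calculable_def)
  ultimately have "finite (component (A \<union> B) (union_label A lA lB) n)" if "1 \<le> n" for n
    using that finite_subset by blast
  then show ?thesis
    using assms by (auto simp: calculable_def union_label_def)
qed

end

theory Submission
  imports Defs
begin

text \<open>
  The number \<open>\<sigma>\<^sub>n(A)\<close> counts the initial part \<open>{x \<in> A. l x \<le> n}\<close> of \<open>A\<close>, which is finite because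
  the labelling is finite-to-one (\<open>finite_initial_part\<close>). These parts exhaust \<open>A\<close>, so every
  claim reduces to elementary facts about cardinalities of finite sets, once \<open>n\<close> is at least
  the labels of the elements that matter: a single element \<open>x\<close> of \<open>A\<close> contributes to \<open>\<sigma>\<^sub>n(A)\<close> for
  all \<open>n \<ge> l x\<close>; a finite \<open>A\<close> equals its initial part as soon as \<open>n\<close> bounds all its labels;
  and if \<open>A \<subset> B\<close>, an element \<open>b \<in> B - A\<close> keeps the initial part of \<open>A\<close> strictly inside that of \<open>B\<close>
  from \<open>n = l b\<close> on, the inclusion itself being the agreement of the two labellings.
  Additivity holds already for each component of a disjoint union, and the last claim is
  the discreteness of the natural numbers.
\<close>

lemma finite_initial_part:
  assumes "calculable A l"
  shows "finite {x \<in> A. l x \<le> n}"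
proof (rule finite_subset)
  show "{x \<in> A. l x \<le> n} \<subseteq> (\<Union>k\<in>{1..n}. component A l k)"
    using assms by (auto simp: calculable_def component_def)
  show "finite (\<Union>k\<in>{1..n}. component A l k)"
    using assms by (auto simp: calculable_def)
qed

lemma size_seq_eq_0_iff:
  assumes "calculable A l"
  shows "(\<forall>n\<ge>1. size_seq A l n = 0) \<longleftrightarrow> A = {}"
proof
  assume zero: "\<forall>n\<ge>1. size_seq A l n = 0"
  show "A = {}"
  proof (rule equals0I)
    fix x assume "x \<in> A"
    then have "size_seq A l (l x) = 0"
      using zero assms by (simp add: calculable_def)
    then have "{y \<in> A. l y \<le> l x} = {}"
      using finite_initial_part[OF assms] by (simp add: size_seq_eq_card[OF assms])
    with \<open>x \<in> A\<close> show False by blast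
  qed
qed (simp add: size_seq_def component_def)

lemma size_seq_finite:
  assumes "calculable A l" and "finite A"
  shows "size_seq A l =\<^sub>\<F> (\<lambda>_. card A)"
proof -
  \<comment> \<open>Inserting 1 keeps the maximum defined for empty \<open>A\<close> and makes the threshold at least 1.\<close>
  define m where "m = Max (insert 1 (l ` A))"
  have "1 \<le> m" and bound: "\<forall>x\<in>A. l x \<le> m"
    using assms(2) by (simp_all add: m_def)
  have "size_seq A l n = card A" if "n > m" for n
  proof -
    have "{x \<in> A. l x \<le> n} = A"
      using bound that by fastforce
    then show ?thesis by (simp add: size_seq_eq_card[OF assms(1)])
  qed
  with \<open>1 \<le> m\<close> show ?thesis by (auto simp: eventually_eq_def)
qed

lemma size_seq_psubset:
  assumes "calculable A lA" and "calculable B lB"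
    and "canonically_arranged A lA B lB" and "A \<subset> B"
  shows "size_seq A lA <\<^sub>\<F> size_seq B lB"
proof -
  obtain b where b: "b \<in> B" "b \<notin> A"
    using assms(4) by blast
  have "size_seq A lA n < size_seq B lB n" if "n > lB b" for n
  proof -
    have "{x \<in> A. lA x \<le> n} \<subseteq> {x \<in> B. lB x \<le> n}"
      using assms(3,4) by (auto simp: canonically_arranged_def)
    moreover have "b \<in> {x \<in> B. lB x \<le> n}" "b \<notin> {x \<in> A. lA x \<le> n}"
      using b that by simp_all
    ultimately have "{x \<in> A. lA x \<le> n} \<subset> {x \<in> B. lB x \<le> n}"
      by blast
    then show ?thesis
      by (simp add: size_seq_eq_card assms(1,2) psubset_card_mono finite_initial_part)
  qed
  moreover have "1 \<le> lB b"
    using assms(2) b(1) by (simp add: calculable_def)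
  ultimately show ?thesis by (auto simp: eventually_less_def)
qed

lemma size_seq_disjoint_Un:
  assumes "calculable A lA" and "calculable B lB" and "A \<inter> B = {}"
  shows "size_seq (A \<union> B) (union_label A lA lB) n = size_seq A lA n + size_seq B lB n"
proof -
  have "card (component (A \<union> B) (union_label A lA lB) k)
      = card (component A lA k) + card (component B lB k)" if "k \<in> {1..n}" for k
  proof -
    have "component (A \<union> B) (union_label A lA lB) k = component A lA k \<union> component B lB k"
      using assms(3) by (auto simp: component_def union_label_def)
    moreover have "component A lA k \<inter> component B lB k = {}"
      using assms(3) by (auto simp: component_def)
    ultimately show ?thesis
      using assms(1,2) that by (simp add: calculable_def card_Un_disjoint)
  qed
  then show ?thesis by (simp add: size_seq_def sum.distrib)
qed

lemma eventually_less_imp_Suc_le: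
  fixes a b :: "nat \<Rightarrow> nat"
  assumes "a <\<^sub>\<F> b"
  shows "(\<lambda>n. a n + 1) \<le>\<^sub>\<F> b"
  using assms by (simp add: eventually_less_def eventually_le_def Suc_le_eq)

theorem mainTheorem1:
  fixes A B :: "'a set" and lA lB :: "'a \<Rightarrow> nat"
  assumes "calculable A lA" and "calculable B lB"
    and "canonically_arranged A lA B lB"
  shows "((\<forall>n\<ge>1. size_seq A lA n = 0) \<longleftrightarrow> A = {})
    \<and> (\<forall>n\<ge>1. finite A \<and> card A = n \<longrightarrow> size_seq A lA =\<^sub>\<F> (\<lambda>_. n))
    \<and> (A \<subset> B \<longrightarrow> size_seq A lA <\<^sub>\<F> size_seq B lB)
    \<and> (A \<inter> B = {} \<longrightarrow>
        (\<forall>n\<ge>1. size_seq (A \<union> B) (union_label A lA lB) n = size_seq A lA n + size_seq B lB n))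
    \<and> (size_seq A lA <\<^sub>\<F> size_seq B lB \<longrightarrow>
        (\<lambda>n. size_seq A lA n + 1) \<le>\<^sub>\<F> size_seq B lB)"
  using size_seq_eq_0_iff[OF assms(1)] size_seq_finite[OF assms(1)] size_seq_psubset[OF assms]
    size_seq_disjoint_Un[OF assms(1,2)] eventually_less_imp_Suc_le
  by blast

end
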